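(* Let $R$ be an integral domain, let $\mathrm{Prp}(R)$ be the set of all proper ideals of $R$, and let $H$ be a subgroup of the group $\mathrm{Perm}(\mathrm{Prp}(R))$ of permutations of $\mathrm{Prp}(R)$. Then $H$ is $\omega$-stable and transitive over $\mathrm{Prp}(R)$ if and only if $R$ is a field.
   Context: For a positive integer $n$, a proper ideal $I$ of a commutative ring $R$ with identity is $n$-absorbing if for all $x_1,\ldots,x_{n+1}\in R$ with $x_1\cdots x_{n+1}\in I$ there are indices $1\le i_1<\cdots<i_n\le n+1$ such that $x_{i_1}\cdots x_{i_n}\in I$. For a proper ideal $I$, $\omega(I)\in\mathbb{N}\cup\{\infty\}$ (with $\mathbb{N}$ the set of positive integers) is the smallest positive integer $n$ such that $I$ is $n$-absorbing, and $\omega(I)=\infty$ if no such $n$ exists. Let $\mathcal{I}$ be a non-empty set of proper ideals of $R$. For $I\in\mathcal{I}$, the $\omega$-orbit of $I$ is $[I]_\omega=\{J\in\mathcal{I} : \omega(J)=\omega(I)\}$. A subgroup $H$ of $\mathrm{Perm}(\mathcal{I})$ acts on $\mathcal{I}$ by evaluation, with orbits $\mathrm{Orb}_H(I)=\{h(I): h\in H\}$. $H$ is $\omega$-stable over $\mathcal{I}$ if $\mathrm{Orb}_H(I)\subseteq[I]_\omega$ for all $I\in\mathcal{I}$, i.e. $\omega(h(I))=\omega(I)$ for all $h\in H$, $I\in\mathcal{I}$. $H$ is transitive over $\mathcal{I}$ if for any $I,J\in\mathcal{I}$ there is $h\in H$ with $J=h(I)$. *)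

theory Defs
  imports "HOL-Algebra.Algebra" "HOL-Library.Extended_Nat"
begin

definition proper_ideals :: "('a, 'b) ring_scheme \<Rightarrow> 'a set set" where
  "proper_ideals R = {I. ideal I R \<and> I \<noteq> carrier R}"

(* The choice of indices i_1 < ... < i_n among 1, ..., n+1 is the choice of a subset A of
   {1..n+1} with n elements. *)
definition n_absorbing :: "('a, 'b) ring_scheme \<Rightarrow> nat \<Rightarrow> 'a set \<Rightarrow> bool" where
  "n_absorbing R n I \<longleftrightarrow>
     n \<ge> 1 \<and> I \<in> proper_ideals R \<and>
     (\<forall>x. x \<in> {1..n + 1} \<rightarrow> carrier R \<longrightarrow> finprod R x {1..n + 1} \<in> I \<longrightarrow>
        (\<exists>A. A \<subseteq> {1..n + 1} \<and> card A = n \<and> finprod R x A \<in> I))"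

definition omega :: "('a, 'b) ring_scheme \<Rightarrow> 'a set \<Rightarrow> enat" where
  "omega R I =
     (if \<exists>n. n_absorbing R n I then enat (LEAST n. n_absorbing R n I) else \<infinity>)"

definition omega_orbit :: "('a, 'b) ring_scheme \<Rightarrow> 'a set set \<Rightarrow> 'a set \<Rightarrow> 'a set set" where
  "omega_orbit R \<I> I = {J \<in> \<I>. omega R J = omega R I}"

(* Perm(\<I>) is BijGroup \<I>, whose elements are the bijections of \<I> onto itself that are
   undefined outside \<I>. A subgroup H of it acts by evaluation, i.e. through the inclusion
   of H into BijGroup \<I>. *)
abbreviation perm_subgroup :: "'c set \<Rightarrow> ('c \<Rightarrow> 'c) set \<Rightarrow> ('c \<Rightarrow> 'c) monoid" where
  "perm_subgroup \<I> H \<equiv> (BijGroup \<I>)\<lparr>carrier := H\<rparr>"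

definition omega_stable ::
  "('a, 'b) ring_scheme \<Rightarrow> 'a set set \<Rightarrow> ('a set \<Rightarrow> 'a set) set \<Rightarrow> bool" where
  "omega_stable R \<I> H \<longleftrightarrow>
     (\<forall>I\<in>\<I>. orbit (perm_subgroup \<I> H) (\<lambda>h. h) I \<subseteq> omega_orbit R \<I> I)"

definition transitive_over :: "'c set \<Rightarrow> ('c \<Rightarrow> 'c) set \<Rightarrow> bool" where
  "transitive_over \<I> H \<longleftrightarrow> transitive_action (perm_subgroup \<I> H) \<I> (\<lambda>h. h)"

lemma perm_subgroup_action:
  assumes "subgroup H (BijGroup \<I>)"
  shows "group_action (perm_subgroup \<I> H) \<I> (\<lambda>h. h)"
proof -
  have "group (perm_subgroup \<I> H)"
    using assms group_BijGroup by (rule subgroup.subgroup_is_group)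
  moreover have "(\<lambda>h. h) \<in> hom (perm_subgroup \<I> H) (BijGroup \<I>)"
    using subgroup.subset[OF assms] by (auto simp: hom_def)
  ultimately show ?thesis
    by (simp add: group_action_def group_hom_def group_hom_axioms_def group_BijGroup)
qed

lemma transitive_over_iff:
  assumes "subgroup H (BijGroup \<I>)"
  shows "transitive_over \<I> H \<longleftrightarrow> (\<forall>I\<in>\<I>. \<forall>J\<in>\<I>. \<exists>h\<in>H. J = h I)"
  using perm_subgroup_action[OF assms]
  by (auto simp: transitive_over_def transitive_action_def transitive_action_axioms_def eq_commute)

lemma omega_stable_iff:
  assumes "subgroup H (BijGroup \<I>)"
  shows "omega_stable R \<I> H \<longleftrightarrow> (\<forall>h\<in>H. \<forall>I\<in>\<I>. omega R (h I) = omega R I)"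
proof -
  have "h I \<in> \<I>" if "h \<in> H" "I \<in> \<I>" for h I
    using group_action.element_image[OF perm_subgroup_action[OF assms]] that by simp
  then show ?thesis
    unfolding omega_stable_def orbit_def omega_orbit_def by (simp add: subset_iff) blast
qed

end

theory Submission
  imports Defs
begin

text \<open>
  The zero ideal of a domain is prime, and the 1-absorbing ideals are exactly the prime ones, so
  its \<open>omega\<close> is 1, the least possible value. A transitive group moves the zero ideal to every
  other proper ideal, and \<open>omega\<close>-stability keeps the value along the way; hence a group with
  both properties forces every proper ideal to be prime. A domain in which this happens is a field:
  for every nonzero \<open>a\<close> the principal ideal of the square of \<open>a\<close> contains \<open>a\<close>, and cancelling \<open>a\<close>
  in the resulting equation gives an inverse.

  Conversely, a field has just one proper ideal, so both properties hold for any group at all.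
\<close>

text \<open>
  For \<open>n = 1\<close> the sets of indices to choose from are the two singletons, so the condition is the
  one that defines primality, with the two factors listed as a family.
\<close>

lemma (in cring) one_absorbing_iff_prime: "n_absorbing R 1 I \<longleftrightarrow> primeideal I R"
proof
  assume abs: "n_absorbing R 1 I"
  then have I: "ideal I R" "carrier R \<noteq> I"
    by (auto simp: n_absorbing_def proper_ideals_def)
  show "primeideal I R"
  proof (rule primeidealI[OF I(1) is_cring I(2)])
    fix a b assume ab: "a \<in> carrier R" "b \<in> carrier R" "a \<otimes> b \<in> I"
    define x where "x = (\<lambda>i::nat. if i = 1 then a else b)"
    have two: "{1..1 + 1} = {1, 2::nat}"
      by auto
    have x: "x \<in> {1..1 + 1} \<rightarrow> carrier R" "finprod R x {1..1 + 1} = a \<otimes> b"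
      using ab unfolding two by (auto simp: x_def)
    then obtain A where A: "A \<subseteq> {1, 2}" "card A = 1" "finprod R x A \<in> I"
      using abs ab(3) unfolding n_absorbing_def two by metis
    from A(1,2) have "A = {1} \<or> A = {2}"
      by (auto simp: card_1_singleton_iff)
    then show "a \<in> I \<or> b \<in> I"
      using A(3) ab by (auto simp: x_def)
  qed
next
  assume "primeideal I R"
  then interpret I: primeideal I R .
  have "\<exists>A. A \<subseteq> {1..1 + 1} \<and> card A = 1 \<and> finprod R x A \<in> I"
    if x: "x \<in> {1..1 + 1} \<rightarrow> carrier R" "finprod R x {1..1 + 1} \<in> I" for x :: "nat \<Rightarrow> 'a"
  proof -
    have two: "{1..1 + 1} = {1, 2::nat}"
      by auto
    have c: "x 1 \<in> carrier R" "x 2 \<in> carrier R"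
      using x(1) unfolding two by auto
    then have "finprod R x {1..1 + 1} = x 1 \<otimes> x 2"
      unfolding two by simp
    then obtain i where "i \<in> {1, 2}" "x i \<in> I"
      using I.I_prime[OF c] x(2) by auto
    then show ?thesis
      using c unfolding two by (intro exI[of _ "{i}"]) auto
  qed
  then show "n_absorbing R 1 I"
    using I.is_ideal I.I_notcarr unfolding n_absorbing_def proper_ideals_def by auto
qed

lemma (in cring) omega_eq_one_iff_prime: "omega R I = 1 \<longleftrightarrow> primeideal I R"
proof -
  have "omega R I = 1 \<longleftrightarrow> n_absorbing R 1 I"
  proof
    assume "omega R I = 1"
    then have "\<exists>n. n_absorbing R n I" "(LEAST n. n_absorbing R n I) = 1"
      by (auto simp: omega_def one_enat_def split: if_splits)
    then show "n_absorbing R 1 I"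
      by (metis LeastI_ex)
  next
    assume abs: "n_absorbing R 1 I"
    then have "(LEAST n. n_absorbing R n I) = 1"
      by (intro Least_equality) (auto simp: n_absorbing_def)
    then show "omega R I = 1"
      using abs by (auto simp: omega_def one_enat_def)
  qed
  then show ?thesis
    by (simp only: one_absorbing_iff_prime)
qed

text \<open>
  The argument rests on the principal ideal of \<open>a \<otimes> a\<close>: whether it is prime or the whole ring,
  it contains \<open>a\<close>, so \<open>a\<close> is a multiple of its own square.
\<close>

lemma (in domain) field_if_proper_ideals_prime:
  assumes prime: "\<And>I. I \<in> proper_ideals R \<Longrightarrow> primeideal I R"
  shows "field R"
proof (rule cring_fieldI2)
  show "\<zero> \<noteq> \<one>"
    by simp
next
  fix a assume a: "a \<in> carrier R" "a \<noteq> \<zero>"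
  let ?I = "PIdl (a \<otimes> a)"
  have I: "ideal ?I R"
    using a by (simp add: cgenideal_ideal)
  have "a \<in> ?I"
  proof (cases "?I = carrier R")
    case False
    then interpret I: primeideal ?I R
      using I by (intro prime) (simp add: proper_ideals_def)
    show ?thesis
      using I.I_prime[of a a] a cgenideal_self[of "a \<otimes> a"] by simp
  qed (use a in simp)
  then obtain r where r: "r \<in> carrier R" "a = r \<otimes> (a \<otimes> a)"
    by (auto simp: cgenideal_def)
  then have "a \<otimes> \<one> = a \<otimes> (r \<otimes> a)"
    using a by (simp add: m_lcomm)
  then have "r \<otimes> a = \<one>"
    using a r m_lcancel[of a \<one> "r \<otimes> a"] by simp
  then show "\<exists>b\<in>carrier R. a \<otimes> b = \<one>"
    using a r m_comm[of r a] by auto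
qed

lemma (in field) proper_ideals_eq: "proper_ideals R = {{\<zero>}}"
  using all_ideals carrier_one_not_zero by (auto simp: proper_ideals_def)

theorem corollary4p3:
  fixes R :: "('a, 'b) ring_scheme"
    and H :: "('a set \<Rightarrow> 'a set) set"
  assumes "domain R"
    and "subgroup H (BijGroup (proper_ideals R))"
  shows "omega_stable R (proper_ideals R) H \<and> transitive_over (proper_ideals R) H \<longleftrightarrow> field R"
proof -
  interpret domain R by fact
  show ?thesis
  proof
    assume "omega_stable R (proper_ideals R) H \<and> transitive_over (proper_ideals R) H"
    then have stable: "\<And>h I. h \<in> H \<Longrightarrow> I \<in> proper_ideals R \<Longrightarrow> omega R (h I) = omega R I"
      and trans: "\<And>I J. I \<in> proper_ideals R \<Longrightarrow> J \<in> proper_ideals R \<Longrightarrow> \<exists>h\<in>H. J = h I"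
      by (simp_all add: omega_stable_iff[OF assms(2)] transitive_over_iff[OF assms(2)])
    have zero_prime: "primeideal {\<zero>\<^bsub>R\<^esub>} R"
      using domain_eq_zeroprimeideal domain_axioms by simp
    then have zero: "{\<zero>\<^bsub>R\<^esub>} \<in> proper_ideals R"
      using primeideal.I_notcarr by (auto simp: proper_ideals_def zeroideal)
    show "field R"
    proof (rule field_if_proper_ideals_prime)
      fix J assume "J \<in> proper_ideals R"
      then obtain h where "h \<in> H" "J = h {\<zero>\<^bsub>R\<^esub>}"
        using trans zero by blast
      then have "omega R J = omega R {\<zero>\<^bsub>R\<^esub>}"
        using stable zero by simp
      then show "primeideal J R"
        using zero_prime by (simp flip: omega_eq_one_iff_prime)
    qed
  next
    assume "field R"
    then interpret field R .
    let ?P = "proper_ideals R"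
    have fixed: "h {\<zero>\<^bsub>R\<^esub>} = {\<zero>\<^bsub>R\<^esub>}" if "h \<in> H" for h
      using group_action.element_image[OF perm_subgroup_action[OF assms(2)], of h "{\<zero>\<^bsub>R\<^esub>}"] that
      by (simp add: proper_ideals_eq)
    have "omega_stable R ?P H"
      using fixed unfolding omega_stable_iff[OF assms(2)] unfolding proper_ideals_eq by fastforce
    moreover have "transitive_over ?P H"
      using fixed subgroup.one_closed[OF assms(2)]
      unfolding transitive_over_iff[OF assms(2)] unfolding proper_ideals_eq by blast
    ultimately show "omega_stable R ?P H \<and> transitive_over ?P H"
      by simp
  qed
qed

end
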